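(* Let $g$ be a real spherical harmonic of degree $\ell\ge2$ on $S^2$, and let $\mathbf{c}=\mathbf{c}(\varepsilon)$ be the centroid of the homogeneous body $B_\varepsilon$ with radial boundary $r(u)=1+\varepsilon g(u)$, $u\in S^2$. Then $\mathbf{c}(\varepsilon)=O(\varepsilon^2)$ as $\varepsilon\to0$. If moreover $g=Y_\ell^m$ with $2\le m\le\ell$, then $\mathbf{c}(\varepsilon)=\mathbf{0}$ exactly, for every $\varepsilon$ for which $B_\varepsilon$ is a body (i.e. for which $1+\varepsilon g>0$ on $S^2$).
   Context: A spherical harmonic of degree $\ell$ is the restriction to the unit sphere $S^2\subset\mathbb{R}^3$ of a homogeneous harmonic polynomial of degree $\ell$. With colatitude $\theta\in[0,\pi]$ and longitude $\phi$, for $1\le m\le\ell$ the real harmonic $Y_\ell^m$ is $Y_\ell^m(\theta,\phi)=P_\ell^m(\cos\theta)\cos(m\phi)$, where $P_\ell^m(x)=(1-x^2)^{m/2}\,\frac{d^m}{dx^m}P_\ell(x)$ and $P_\ell$ is the Legendre polynomial of degree $\ell$. For $\varepsilon$ with $r(u)=1+\varepsilon g(u)>0$ on $S^2$, $B_\varepsilon=\{t\,u:u\in S^2,\ 0\le t\le r(u)\}$, taken with uniform mass density; its centroid is $\mathbf{c}(\varepsilon)=\frac{1}{\mathrm{vol}(B_\varepsilon)}\int_{B_\varepsilon}x\,dV$. *)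

theory Defs
  imports "HOL-Analysis.Analysis" "HOL-Computational_Algebra.Polynomial"
    "HOL-Library.Landau_Symbols"
begin

definition homogeneous_polynomial :: "nat \<Rightarrow> (real ^ 3 \<Rightarrow> real) \<Rightarrow> bool" where
  "homogeneous_polynomial l p \<longleftrightarrow>
     (\<exists>c :: nat \<Rightarrow> nat \<Rightarrow> nat \<Rightarrow> real. \<forall>x.
        p x = (\<Sum>(i, j, k)\<in>{(i, j, k). i + j + k = l}. c i j k * (x $ 1) ^ i * (x $ 2) ^ j * (x $ 3) ^ k))"

lemma finite_exponents: "finite {(i, j, k). i + j + k = (l :: nat)}"
  by (rule finite_subset[of _ "{..l} \<times> {..l} \<times> {..l}"]) auto

definition partial_deriv :: "3 \<Rightarrow> (real ^ 3 \<Rightarrow> real) \<Rightarrow> real ^ 3 \<Rightarrow> real" where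
  "partial_deriv i f x = deriv (\<lambda>t. f (x + t *\<^sub>R axis i 1)) 0"

definition laplacian :: "(real ^ 3 \<Rightarrow> real) \<Rightarrow> real ^ 3 \<Rightarrow> real" where
  "laplacian f x = (\<Sum>i\<in>UNIV. partial_deriv i (partial_deriv i f) x)"

text \<open>Functions on the unit sphere are represented by functions on the whole space of which only
  the values on \<^term>\<open>sphere 0 1\<close> matter.\<close>

definition spherical_harmonic :: "nat \<Rightarrow> (real ^ 3 \<Rightarrow> real) \<Rightarrow> bool" where
  "spherical_harmonic l g \<longleftrightarrow>
     (\<exists>p. homogeneous_polynomial l p \<and> (\<forall>x. laplacian p x = 0) \<and> (\<forall>u\<in>sphere 0 1. g u = p u))"

text \<open>Rodrigues' formula.\<close>

definition legendre_poly :: "nat \<Rightarrow> real poly" where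
  "legendre_poly l = smult (1 / (2 ^ l * fact l)) ((pderiv ^^ l) ([:-1, 0, 1:] ^ l))"

text \<open>\<open>sqrt (1 - x\<^sup>2) ^ m\<close> stands for \<open>(1 - x\<^sup>2) powr (m / 2)\<close>; the two differ on \<open>[-1, 1]\<close> only for
  \<open>m = 0\<close> at the end points, where the latter is \<open>0\<close>.\<close>

definition assoc_legendre :: "nat \<Rightarrow> nat \<Rightarrow> real \<Rightarrow> real" where
  "assoc_legendre l m x = sqrt (1 - x\<^sup>2) ^ m * poly ((pderiv ^^ m) (legendre_poly l)) x"

definition Y_angles :: "nat \<Rightarrow> nat \<Rightarrow> real \<Rightarrow> real \<Rightarrow> real" where
  "Y_angles l m \<theta> \<phi> = assoc_legendre l m (cos \<theta>) * cos (real m * \<phi>)"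

definition sphere_point :: "real \<Rightarrow> real \<Rightarrow> real ^ 3" where
  "sphere_point \<theta> \<phi> = vector [sin \<theta> * cos \<phi>, sin \<theta> * sin \<phi>, cos \<theta>]"

definition colatitude :: "real ^ 3 \<Rightarrow> real" where
  "colatitude u = arccos (u $ 3)"

definition longitude :: "real ^ 3 \<Rightarrow> real" where
  "longitude u = Arg (Complex (u $ 1) (u $ 2))"

text \<open>The harmonic as a function of the point of the sphere. The longitude of a pole is arbitrary,
  but for \<open>m \<ge> 1\<close> the harmonic vanishes there.\<close>

definition Y_sphere :: "nat \<Rightarrow> nat \<Rightarrow> real ^ 3 \<Rightarrow> real" where
  "Y_sphere l m u = Y_angles l m (colatitude u) (longitude u)"

lemma sphere_point_angles:
  assumes "norm u = 1"
  shows "sphere_point (colatitude u) (longitude u) = u"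
proof -
  have n: "(u $ 1)\<^sup>2 + (u $ 2)\<^sup>2 + (u $ 3)\<^sup>2 = 1"
    using assms by (simp add: norm_vec_def L2_set_def sum_3)
  have "\<bar>u $ 3\<bar> \<le> 1"
    using component_le_norm_cart[of u 3] assms by simp
  then have c: "cos (colatitude u) = u $ 3" and
    "sin (colatitude u) = sqrt (1 - (u $ 3)\<^sup>2)"
    by (simp_all add: colatitude_def cos_arccos_abs sin_arccos_abs)
  moreover have "1 - (u $ 3)\<^sup>2 = (u $ 1)\<^sup>2 + (u $ 2)\<^sup>2"
    using n by simp
  ultimately have s: "sin (colatitude u) = cmod (Complex (u $ 1) (u $ 2))"
    by (simp add: cmod_def)
  have "of_real (cmod z) * cis (Arg z) = z" for z
    using rcis_cmod_Arg[of z] by (simp add: rcis_def)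
  from this[of "Complex (u $ 1) (u $ 2)"]
  have "cmod (Complex (u $ 1) (u $ 2)) * cos (longitude u) = u $ 1"
    "cmod (Complex (u $ 1) (u $ 2)) * sin (longitude u) = u $ 2"
    by (simp_all add: longitude_def complex_eq_iff)
  then show ?thesis
    using c s by (simp add: sphere_point_def vec_eq_iff forall_3)
qed

lemma Y_sphere_point:
  assumes "0 \<le> \<theta>" "\<theta> \<le> pi" "m \<ge> 1"
  shows "Y_sphere l m (sphere_point \<theta> \<phi>) = Y_angles l m \<theta> \<phi>"
proof (cases "sin \<theta> = 0")
  case True
  then have "(cos \<theta>)\<^sup>2 = 1"
    using sin_cos_squared_add[of \<theta>] by simp
  then have "assoc_legendre l m (cos \<theta>) = 0"
    using assms(3) by (simp add: assoc_legendre_def)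
  then show ?thesis
    using assms(1,2) by (simp add: Y_sphere_def Y_angles_def colatitude_def sphere_point_def arccos_cos)
next
  case False
  then have pos: "sin \<theta> > 0"
    using assms sin_ge_zero[of \<theta>] by simp
  have "Complex (sin \<theta> * cos \<phi>) (sin \<theta> * sin \<phi>) = of_real (sin \<theta>) * cis \<phi>"
    by (simp add: complex_eq_iff)
  then have "longitude (sphere_point \<theta> \<phi>) = Arg (cis \<phi>)"
    using pos by (simp add: longitude_def sphere_point_def)
  moreover have "cis (Arg (cis \<phi>)) = cis \<phi>"
    using rcis_cmod_Arg[of "cis \<phi>"] by (simp add: rcis_def)
  ultimately have "cis (real m * longitude (sphere_point \<theta> \<phi>)) = cis (real m * \<phi>)"
    by (metis Complex.DeMoivre)
  then have "cos (real m * longitude (sphere_point \<theta> \<phi>)) = cos (real m * \<phi>)"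
    by (metis cis.sel(1))
  then show ?thesis
    using assms by (simp add: Y_sphere_def Y_angles_def colatitude_def sphere_point_def arccos_cos)
qed

definition body :: "(real ^ 3 \<Rightarrow> real) \<Rightarrow> real \<Rightarrow> (real ^ 3) set" where
  "body g \<epsilon> = {t *\<^sub>R u | t u. u \<in> sphere 0 1 \<and> 0 \<le> t \<and> t \<le> 1 + \<epsilon> * g u}"

definition centroid :: "(real ^ 3) set \<Rightarrow> real ^ 3" where
  "centroid B = (1 / measure lebesgue B) *\<^sub>R (LINT x:B|lebesgue. x)"

end

theory Submission
  imports Defs
begin

text \<open>Extend \<open>g\<close> from the sphere to a function \<open>G\<close> that is constant along rays. The radial map
  \<open>x \<mapsto> (1 + \<epsilon> * G x) *\<^sub>R x\<close> carries the unit ball to the body, and its Jacobian determinant is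
  \<open>(1 + \<epsilon> * G x) ^ 3\<close>, so the first moment of the body is the integral of
  \<open>(1 + \<epsilon> * G x) ^ 4 *\<^sub>R x\<close> over the ball (lemma \<open>integral_body\<close>). This replaces an integral over the
  sphere in polar coordinates. The constant term of the expansion in \<open>\<epsilon>\<close> integrates to \<open>0\<close> by
  symmetry. The linear term is the integral of \<open>G x *\<^sub>R x\<close>, which vanishes because harmonics of
  degree \<open>l \<ge> 2\<close> are orthogonal to those of degree 1, the coordinates. So the first moment is of
  order \<open>\<epsilon>\<^sup>2\<close>, and division by the volume, which is bounded away from \<open>0\<close>, does not change this.

  The orthogonality (lemma \<open>has_integral_harmonic_coord\<close>) is derived from rotation invariance alone:
  the integral over the ball of \<open>(x\<^sub>i \<partial>\<^sub>j - x\<^sub>j \<partial>\<^sub>i) f\<close> times a radial weight is \<open>0\<close> for every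
  homogeneous polynomial \<open>f\<close>, and two such families of identities, together with Euler's identity
  and harmonicity, force the first moments of the harmonic polynomial to vanish.

  For \<open>g = Y\<^sub>l\<^sup>m\<close> with \<open>m \<ge> 2\<close> the body itself is symmetric: under the rotation by \<open>2 * pi / m\<close> about the
  third axis, which forces the centroid onto this axis, and under a reflection in the equatorial
  plane, followed by a rotation by \<open>pi / m\<close> if \<open>l + m\<close> is odd, which reverses the axis. These
  symmetries hold for every \<open>\<epsilon>\<close>, not only for small ones.\<close>

section \<open>Homogeneous polynomials in three variables\<close>

text \<open>Homogeneous polynomial functions of degree \<open>d\<close>, generated instead of written in coordinates:
  every fact below then has a proof by induction, without any bookkeeping of exponents.\<close>

inductive hompoly :: "nat \<Rightarrow> (real ^ 3 \<Rightarrow> real) \<Rightarrow> bool" where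
  const: "hompoly 0 (\<lambda>x. c)"
| coord: "hompoly d p \<Longrightarrow> hompoly (Suc d) (\<lambda>x. x $ i * p x)"
| add: "hompoly d p \<Longrightarrow> hompoly d q \<Longrightarrow> hompoly d (\<lambda>x. p x + q x)"

lemma hompoly_zero: "hompoly d (\<lambda>x. 0)"
proof (induction d)
  case (Suc d)
  then show ?case using hompoly.coord[of d "\<lambda>x. 0" 1] by simp
qed (rule hompoly.const)

lemma hompoly_sum:
  assumes "\<And>a. a \<in> A \<Longrightarrow> hompoly d (p a)"
  shows "hompoly d (\<lambda>x. \<Sum>a\<in>A. p a x)"
  using assms by (induction A rule: infinite_finite_induct) (auto intro: hompoly_zero hompoly.add)

lemma hompoly_scale: "hompoly d p \<Longrightarrow> hompoly d (\<lambda>x. c * p x)"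
proof (induction rule: hompoly.induct)
  case (coord d p i)
  from hompoly.coord[OF coord.IH, of i] show ?case by (simp add: mult.left_commute)
qed (auto simp: distrib_left intro: hompoly.const hompoly.add)

lemma hompoly_coord_power: "hompoly d p \<Longrightarrow> hompoly (n + d) (\<lambda>x. x $ i ^ n * p x)"
proof (induction n)
  case (Suc n)
  from hompoly.coord[OF Suc.IH[OF Suc.prems], of i] show ?case by (simp add: mult.assoc)
qed simp

lemma homogeneous_polynomial_imp_hompoly:
  assumes "homogeneous_polynomial l p"
  shows "hompoly l p"
proof -
  obtain c where c: "\<And>x. p x = (\<Sum>(i, j, k)\<in>{(i, j, k). i + j + k = l}.
      c i j k * (x $ 1) ^ i * (x $ 2) ^ j * (x $ 3) ^ k)"
    using assms unfolding homogeneous_polynomial_def by blast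
  have "hompoly (i + (j + (k + 0))) (\<lambda>x. x $ 1 ^ i * (x $ 2 ^ j * (x $ 3 ^ k * c i j k)))" for i j k
    by (intro hompoly_coord_power hompoly.const)
  then have "hompoly l (\<lambda>x. c i j k * (x $ 1) ^ i * (x $ 2) ^ j * (x $ 3) ^ k)"
    if "i + j + k = l" for i j k
    using that by (auto simp: mult_ac add_ac)
  then have "hompoly l (\<lambda>x. \<Sum>a\<in>{(i, j, k). i + j + k = l}.
      (case a of (i, j, k) \<Rightarrow> c i j k * (x $ 1) ^ i * (x $ 2) ^ j * (x $ 3) ^ k))"
    by (intro hompoly_sum) auto
  then show ?thesis
    by (simp add: c[abs_def])
qed

lemma hompoly_scaleR: "hompoly d p \<Longrightarrow> p (c *\<^sub>R x) = c ^ d * p x"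
  by (induction rule: hompoly.induct) (auto simp: algebra_simps)

text \<open>This bound keeps \<open>p x * W (norm x)\<close> integrable at the origin when the weight \<open>W\<close> is singular
  there.\<close>

lemma hompoly_bound: "hompoly d p \<Longrightarrow> \<exists>C\<ge>0. \<forall>x. \<bar>p x\<bar> \<le> C * norm x ^ d"
proof (induction rule: hompoly.induct)
  case (const c)
  then show ?case by (intro exI[of _ "\<bar>c\<bar>"]) auto
next
  case (coord d p i)
  then obtain C where C: "C \<ge> 0" "\<And>x. \<bar>p x\<bar> \<le> C * norm x ^ d" by auto
  have "\<bar>x $ i * p x\<bar> \<le> C * norm x ^ Suc d" for x
    using mult_mono[OF component_le_norm_cart[of x i] C(2)[of x]] by (simp add: abs_mult mult_ac)
  with C(1) show ?case by blast
next
  case (add d p q)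
  then obtain C D where "C \<ge> 0" "\<And>x. \<bar>p x\<bar> \<le> C * norm x ^ d" "D \<ge> 0" "\<And>x. \<bar>q x\<bar> \<le> D * norm x ^ d"
    by blast
  then have "\<bar>p x + q x\<bar> \<le> (C + D) * norm x ^ d" for x
    by (smt (verit) distrib_right)
  with \<open>C \<ge> 0\<close> \<open>D \<ge> 0\<close> show ?case by (intro exI[of _ "C + D"]) auto
qed

lemma hompoly_0_const: "hompoly d p \<Longrightarrow> d = 0 \<Longrightarrow> \<exists>c. p = (\<lambda>x. c)"
  by (induction rule: hompoly.induct) auto

lemma sum_axis_mult:
  fixes D :: "'n::finite \<Rightarrow> real"
  shows "(\<Sum>j\<in>UNIV. axis i 1 $ j * D j) = D i"
  by (simp add: axis_def if_distrib[where f = "\<lambda>a. a * _"] cong: if_cong)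

text \<open>This reads partial derivatives off a total derivative, so that the calculus below needs no
  difference quotients along the axes.\<close>

lemma partial_derivI:
  assumes "(f has_derivative (\<lambda>v. \<Sum>i\<in>UNIV. v $ i * D i)) (at x)"
  shows "partial_deriv i f x = D i"
proof -
  have "((\<lambda>t. x + t *\<^sub>R axis i 1) has_derivative (\<lambda>t. t *\<^sub>R axis i 1)) (at 0)"
    by (auto intro!: derivative_eq_intros)
  then have "((\<lambda>t. f (x + t *\<^sub>R axis i 1)) has_derivative
      (\<lambda>t. \<Sum>j\<in>UNIV. (t *\<^sub>R axis i 1) $ j * D j)) (at 0)"
    by (rule has_derivative_compose) (simp add: assms)
  also have "(\<lambda>t. \<Sum>j\<in>UNIV. (t *\<^sub>R axis i 1 :: real ^ 3) $ j * D j) = (\<lambda>t. D i * t)"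
    by (simp add: mult.assoc sum_axis_mult mult.commute[of "D i"] flip: sum_distrib_left)
  finally show ?thesis
    by (simp add: partial_deriv_def has_field_derivative_def DERIV_imp_deriv)
qed

lemma has_derivative_coord_mult:
  fixes f :: "real ^ 3 \<Rightarrow> real"
  assumes "(f has_derivative (\<lambda>v. \<Sum>i\<in>UNIV. v $ i * D i)) (at x)"
  shows "((\<lambda>x. x $ j * f x) has_derivative
    (\<lambda>v. \<Sum>i\<in>UNIV. v $ i * ((if i = j then f x else 0) + x $ j * D i))) (at x)"
proof -
  have "((\<lambda>x. x $ j * f x) has_derivative
    (\<lambda>v. x $ j * (\<Sum>i\<in>UNIV. v $ i * D i) + v $ j * f x)) (at x)"
    by (intro has_derivative_mult assms bounded_linear_imp_has_derivative bounded_linear_vec_nth)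
  then show ?thesis
    by (simp add: algebra_simps sum.distrib sum_distrib_left if_distrib[where f = "\<lambda>a. _ * a"] cong: if_cong)
qed

text \<open>With truncated subtraction the degree \<open>d - 1\<close> is right for constants too: their gradient is
  \<open>0\<close>, which is homogeneous of every degree.\<close>

lemma hompoly_gradient_exists:
  "hompoly d p \<Longrightarrow> \<exists>D. (\<forall>i. hompoly (d - 1) (D i)) \<and>
     (\<forall>x. (p has_derivative (\<lambda>v. \<Sum>i\<in>UNIV. v $ i * D i x)) (at x))"
proof (induction rule: hompoly.induct)
  case (const c)
  then show ?case
    by (intro exI[of _ "\<lambda>i x. 0"]) (auto intro: hompoly_zero)
next
  case (coord d p j)
  from coord.IH obtain D where "(\<forall>i. hompoly (d - 1) (D i)) \<and>
    (\<forall>x. (p has_derivative (\<lambda>v. \<Sum>i\<in>UNIV. v $ i * D i x)) (at x))" ..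
  then have D: "hompoly (d - 1) (D i)"
    "(p has_derivative (\<lambda>v. \<Sum>i\<in>UNIV. v $ i * D i x)) (at x)" for i x
    by simp_all
  have "hompoly d (\<lambda>x. x $ j * D i x)" for i
  proof (cases d)
    case 0
    (* Here "d - 1 = d", and the degree count works only because the gradient of a constant is 0. *)
    then obtain c where "p = (\<lambda>x. c)" using coord(1) hompoly_0_const by blast
    then have "(p has_derivative (\<lambda>v. \<Sum>i\<in>UNIV. v $ i * 0)) (at x)" for x
      by simp
    from partial_derivI[OF D(2), of i] partial_derivI[OF this, of i] have "D i x = 0" for x
      by metis
    then show ?thesis by (simp add: hompoly_zero)
  next
    case (Suc n)
    then show ?thesis using hompoly.coord[OF D(1)[of i], of j] by simp
  qed
  moreover have "hompoly d (\<lambda>x. if i = j then p x else 0)" for i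
    by (cases "i = j") (auto intro: coord(1) hompoly_zero)
  ultimately show ?case
    by (intro exI[of _ "\<lambda>i x. (if i = j then p x else 0) + x $ j * D i x"])
      (auto intro!: hompoly.add has_derivative_coord_mult[OF D(2)])
next
  case (add d p q)
  then obtain D E where "(\<forall>i. hompoly (d - 1) (D i)) \<and>
    (\<forall>x. (p has_derivative (\<lambda>v. \<Sum>i\<in>UNIV. v $ i * D i x)) (at x))"
    "(\<forall>i. hompoly (d - 1) (E i)) \<and>
    (\<forall>x. (q has_derivative (\<lambda>v. \<Sum>i\<in>UNIV. v $ i * E i x)) (at x))" by (elim exE)
  then have D: "hompoly (d - 1) (D i)"
    "(p has_derivative (\<lambda>v. \<Sum>i\<in>UNIV. v $ i * D i x)) (at x)"
   and E: "hompoly (d - 1) (E i)"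
    "(q has_derivative (\<lambda>v. \<Sum>i\<in>UNIV. v $ i * E i x)) (at x)" for i x
    by simp_all
  then show ?case
    by (intro exI[of _ "\<lambda>i x. D i x + E i x"])
      (auto intro!: hompoly.add has_derivative_eq_rhs[OF has_derivative_add[OF D(2) E(2)]]
        simp: algebra_simps sum.distrib)
qed

lemma
  assumes "hompoly d p"
  shows hompoly_has_derivative:
      "(p has_derivative (\<lambda>v. \<Sum>i\<in>UNIV. v $ i * partial_deriv i p x)) (at x)"
    and hompoly_partial_deriv: "hompoly (d - 1) (partial_deriv i p)"
proof -
  from hompoly_gradient_exists[OF assms] obtain D where "(\<forall>i. hompoly (d - 1) (D i)) \<and>
    (\<forall>x. (p has_derivative (\<lambda>v. \<Sum>i\<in>UNIV. v $ i * D i x)) (at x))" ..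
  then have D: "hompoly (d - 1) (D i)"
    "(p has_derivative (\<lambda>v. \<Sum>i\<in>UNIV. v $ i * D i x)) (at x)" for i x
    by simp_all
  moreover have "partial_deriv i p = D i" for i
    using partial_derivI[OF D(2)] by blast
  ultimately show "(p has_derivative (\<lambda>v. \<Sum>i\<in>UNIV. v $ i * partial_deriv i p x)) (at x)"
    "hompoly (d - 1) (partial_deriv i p)" by simp_all
qed

lemma partial_deriv_coord_mult:
  assumes "hompoly d p"
  shows "partial_deriv i (\<lambda>x. x $ j * p x) x = (if i = j then p x else 0) + x $ j * partial_deriv i p x"
  by (rule partial_derivI[OF has_derivative_coord_mult[OF hompoly_has_derivative[OF assms]]])

text \<open>Euler's identity: both sides are the derivative of \<open>p (t *\<^sub>R x) = t ^ d * p x\<close> at \<open>t = 1\<close>.\<close>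

lemma hompoly_euler:
  assumes "hompoly d p"
  shows "(\<Sum>i\<in>UNIV. x $ i * partial_deriv i p x) = d * p x"
proof -
  have "((\<lambda>t. t *\<^sub>R x) has_derivative (\<lambda>t. t *\<^sub>R x)) (at 1)"
    by (auto intro!: derivative_eq_intros)
  then have "((\<lambda>t. p (t *\<^sub>R x)) has_derivative
      (\<lambda>t. \<Sum>i\<in>UNIV. (t *\<^sub>R x) $ i * partial_deriv i p x)) (at 1)"
    by (rule has_derivative_compose) (simp add: hompoly_has_derivative[OF assms])
  then have "((\<lambda>t. p (t *\<^sub>R x)) has_field_derivative (\<Sum>i\<in>UNIV. x $ i * partial_deriv i p x)) (at 1)"
    by (simp add: has_field_derivative_def mult.assoc mult.commute[of _ "sum _ _"] flip: sum_distrib_left)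
  moreover have "((\<lambda>t. p (t *\<^sub>R x)) has_field_derivative d * p x) (at 1)"
    unfolding hompoly_scaleR[OF assms] by (auto intro!: derivative_eq_intros)
  ultimately show ?thesis by (rule DERIV_unique)
qed

text \<open>Euler's identity for the partial derivative, which has degree \<open>d - 1\<close>, but with the two
  derivatives in the other order. It is the \<open>k\<close>-th partial derivative of Euler's identity for \<open>p\<close>.\<close>

lemma hompoly_euler_partial_deriv:
  assumes "hompoly d p"
  shows "(\<Sum>i\<in>UNIV. x $ i * partial_deriv k (partial_deriv i p) x) = (real d - 1) * partial_deriv k p x"
proof -
  let ?p = "\<lambda>i. partial_deriv i p"
  have "((\<lambda>x. \<Sum>i\<in>UNIV. x $ i * ?p i x) has_derivative (\<lambda>v. \<Sum>i\<in>UNIV. \<Sum>k\<in>UNIV.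
      v $ k * ((if k = i then ?p i x else 0) + x $ i * partial_deriv k (?p i) x))) (at x)"
    by (intro has_derivative_sum has_derivative_coord_mult hompoly_has_derivative)
      (rule hompoly_partial_deriv[OF assms])
  moreover have "((\<lambda>x. \<Sum>i\<in>UNIV. x $ i * ?p i x) has_derivative
      (\<lambda>v. \<Sum>k\<in>UNIV. v $ k * (d * ?p k x))) (at x)"
    unfolding hompoly_euler[OF assms]
    by (rule has_derivative_eq_rhs[OF has_derivative_mult_right[OF hompoly_has_derivative[OF assms]]])
       (simp add: sum_distrib_left mult_ac)
  ultimately have "(\<lambda>v. \<Sum>i\<in>UNIV. \<Sum>k\<in>UNIV.
      v $ k * ((if k = i then ?p i x else 0) + x $ i * partial_deriv k (?p i) x)) =
      (\<lambda>v. \<Sum>k\<in>UNIV. v $ k * (d * ?p k x))"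
    by (rule has_derivative_unique)
  from fun_cong[OF this, of "axis k 1"]
  have "(\<Sum>i\<in>UNIV. (if k = i then ?p i x else 0) + x $ i * partial_deriv k (?p i) x) = d * ?p k x"
    unfolding sum_axis_mult .
  then show ?thesis
    by (simp add: sum.distrib algebra_simps)
qed

section \<open>Integrals over the punctured ball and rotations\<close>

text \<open>The origin is removed because the degree-zero extension of a function on the sphere is in
  general not even continuous there.\<close>

definition punctured_ball :: "(real ^ 3) set" where
  "punctured_ball = cball 0 1 - {0}"

lemma punctured_ball_measurable: "punctured_ball \<in> lmeasurable"
  unfolding punctured_ball_def by (intro fmeasurable_Diff lmeasurable_cball) simp

lemma absolutely_integrable_punctured_ball:
  fixes f :: "real ^ 3 \<Rightarrow> 'a::euclidean_space"
  assumes "continuous_on punctured_ball f" "\<And>x. x \<in> punctured_ball \<Longrightarrow> norm (f x) \<le> M"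
  shows "f absolutely_integrable_on punctured_ball"
proof (rule measurable_bounded_by_integrable_imp_absolutely_integrable[where g = "\<lambda>x. M"])
  show "punctured_ball \<in> sets lebesgue"
    using punctured_ball_measurable by (rule fmeasurableD)
  then show "f \<in> borel_measurable (lebesgue_on punctured_ball)"
    using assms(1) by (intro continuous_imp_measurable_on_sets_lebesgue)
  show "(\<lambda>x. M) integrable_on punctured_ball"
    using punctured_ball_measurable by (rule integrable_on_const)
qed (rule assms(2))

lemma hompoly_continuous_on: "hompoly d p \<Longrightarrow> continuous_on S p"
  by (rule continuous_at_imp_continuous_on)
    (blast intro: has_derivative_continuous hompoly_has_derivative)

lemma absolutely_integrable_hompoly_radial:
  assumes p: "hompoly d p"
    and W: "continuous_on {0<..1} W" "\<And>r. 0 < r \<Longrightarrow> r \<le> 1 \<Longrightarrow> \<bar>r ^ d * W r\<bar> \<le> M"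
  shows "(\<lambda>x. p x * W (norm x)) absolutely_integrable_on punctured_ball"
proof -
  obtain C where C: "C \<ge> 0" "\<And>x. \<bar>p x\<bar> \<le> C * norm x ^ d"
    using hompoly_bound[OF p] by blast
  show ?thesis
  proof (rule absolutely_integrable_punctured_ball)
    show "continuous_on punctured_ball (\<lambda>x. p x * W (norm x))"
      by (intro continuous_on_mult hompoly_continuous_on[OF p]
          continuous_on_compose2[OF W(1)] continuous_intros)
        (auto simp: punctured_ball_def)
    show "norm (p x * W (norm x)) \<le> C * M" if "x \<in> punctured_ball" for x
    proof -
      have "norm (p x * W (norm x)) \<le> C * norm x ^ d * \<bar>W (norm x)\<bar>"
        using C(2)[of x] by (simp add: abs_mult mult_right_mono)
      also have "\<dots> = C * \<bar>norm x ^ d * W (norm x)\<bar>"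
        by (simp add: abs_mult)
      also have "\<dots> \<le> C * M"
        using that C(1) W(2)[of "norm x"] by (intro mult_left_mono) (auto simp: punctured_ball_def)
      finally show ?thesis .
    qed
  qed
qed

text \<open>An orthogonal map has a Jacobian determinant of absolute value 1.\<close>

lemma integral_orthogonal_image:
  fixes f :: "real ^ 3 \<Rightarrow> real ^ 'n"
  assumes T: "orthogonal_transformation T" and S: "T ` S = S"
    and f: "f absolutely_integrable_on S"
  shows "(\<lambda>x. f (T x)) absolutely_integrable_on S" "integral S (\<lambda>x. f (T x)) = integral S f"
  using has_absolute_integral_change_of_variables_linear[where g = T and f = f and S = S and b = "integral S f"]
    orthogonal_transformation_linear[OF T] orthogonal_transformation_det[OF T] S f
  by simp_all

lemma integral_orthogonal_image_real:
  fixes f :: "real ^ 3 \<Rightarrow> real"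
  assumes T: "orthogonal_transformation T" and S: "T ` S = S"
    and f: "f absolutely_integrable_on S"
  shows "(\<lambda>x. f (T x)) absolutely_integrable_on S" "integral S (\<lambda>x. f (T x)) = integral S f"
proof -
  (* The change of variables theorem speaks of vector-valued functions. *)
  have "(\<lambda>x. vec (f x) :: real ^ 1) absolutely_integrable_on S"
    using f by (simp add: absolutely_integrable_on_1_iff)
  from integral_orthogonal_image[OF T S this]
  show "(\<lambda>x. f (T x)) absolutely_integrable_on S" "integral S (\<lambda>x. f (T x)) = integral S f"
    by (simp_all add: integral_on_1_eq absolutely_integrable_on_1_iff)
qed

lemma orthogonal_transformation_punctured_ball:
  assumes T: "orthogonal_transformation T"
  shows "T ` punctured_ball = punctured_ball"
proof
  have n: "T x \<in> punctured_ball \<longleftrightarrow> x \<in> punctured_ball" for x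
    using orthogonal_transformation_norm[OF T, of x] norm_eq_zero[of x] norm_eq_zero[of "T x"]
    unfolding punctured_ball_def by auto
  then show "T ` punctured_ball \<subseteq> punctured_ball" by blast
  show "punctured_ball \<subseteq> T ` punctured_ball"
  proof
    fix y assume "y \<in> punctured_ball"
    moreover obtain x where "y = T x"
      using orthogonal_transformation_surj[OF T] by (metis surjD)
    ultimately show "y \<in> T ` punctured_ball" using n by blast
  qed
qed

definition plane_rotation :: "3 \<Rightarrow> 3 \<Rightarrow> real \<Rightarrow> real ^ 3 \<Rightarrow> real ^ 3" where
  "plane_rotation i j t x = (\<chi> k. if k = i then cos t * x $ i - sin t * x $ j
     else if k = j then sin t * x $ i + cos t * x $ j else x $ k)"

lemma plane_rotation_0: "plane_rotation i j 0 x = x"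
  by (simp add: plane_rotation_def vec_eq_iff)

lemma orthogonal_transformation_plane_rotation:
  assumes "i \<noteq> j"
  shows "orthogonal_transformation (plane_rotation i j t)"
  unfolding orthogonal_transformation
proof (intro conjI allI)
  show "linear (plane_rotation i j t)"
    by (rule linearI) (simp_all add: plane_rotation_def vec_eq_iff algebra_simps)
  fix x :: "real ^ 3"
  have split: "(\<Sum>k\<in>UNIV. (y $ k)\<^sup>2) = (\<Sum>k\<in>UNIV - {i, j}. (y $ k)\<^sup>2) + ((y $ i)\<^sup>2 + (y $ j)\<^sup>2)"
    for y :: "real ^ 3"
    using assms by (subst sum.subset_diff[of "{i, j}"]) auto
  have "(cos t * x $ i - sin t * x $ j)\<^sup>2 + (sin t * x $ i + cos t * x $ j)\<^sup>2 =
     ((sin t)\<^sup>2 + (cos t)\<^sup>2) * ((x $ i)\<^sup>2 + (x $ j)\<^sup>2)"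
    by algebra
  then show "norm (plane_rotation i j t x) = norm x"
    unfolding norm_vec_def L2_set_def real_norm_def power2_abs split
    using assms by (simp add: plane_rotation_def)
qed

text \<open>The vector field \<open>x\<^sub>i \<partial>\<^sub>j - x\<^sub>j \<partial>\<^sub>i\<close> generates the rotations of the \<open>(i, j)\<close> plane.\<close>

lemma hompoly_rotation_derivative:
  assumes p: "hompoly d p" and ij: "i \<noteq> j"
  defines "Dp \<equiv> (\<lambda>x. x $ i * partial_deriv j p x - x $ j * partial_deriv i p x)"
  shows "((\<lambda>t. p (plane_rotation i j t x)) has_field_derivative Dp (plane_rotation i j t x)) (at t)"
proof -
  let ?R = "\<lambda>t. plane_rotation i j t x"
  have "((\<lambda>t. ?R t $ k) has_real_derivative (?R t $ i *\<^sub>R axis j 1 - ?R t $ j *\<^sub>R axis i 1) $ k) (at t)" for k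
    using ij by (cases "k = i"; cases "k = j")
      (auto simp: plane_rotation_def axis_def intro!: derivative_eq_intros)
  then have "((\<lambda>t. ?R t) has_derivative (\<lambda>h. h *\<^sub>R (?R t $ i *\<^sub>R axis j 1 - ?R t $ j *\<^sub>R axis i 1))) (at t)"
    by (subst has_derivative_componentwise_within)
      (auto simp: Basis_vec_def inner_axis has_field_derivative_def mult_commute_abs)
  from has_derivative_compose[OF this hompoly_has_derivative[OF p]]
  have "((\<lambda>t. p (?R t)) has_derivative (\<lambda>h. \<Sum>k\<in>UNIV.
     h * ((?R t $ i *\<^sub>R axis j 1 - ?R t $ j *\<^sub>R axis i 1) $ k * partial_deriv k p (?R t)))) (at t)"
    by (simp add: mult.assoc)
  also have "(\<lambda>h. \<Sum>k\<in>UNIV.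
     h * ((?R t $ i *\<^sub>R axis j 1 - ?R t $ j *\<^sub>R axis i 1) $ k * partial_deriv k p (?R t))) =
     (\<lambda>h. h * (\<Sum>k\<in>UNIV. ?R t $ i * (axis j 1 $ k * partial_deriv k p (?R t))
        - ?R t $ j * (axis i 1 $ k * partial_deriv k p (?R t))))"
    by (simp add: sum_distrib_left left_diff_distrib mult.assoc)
  also have "\<dots> = (\<lambda>h. Dp (?R t) * h)"
    by (simp add: Dp_def sum_subtractf sum_axis_mult mult.commute flip: sum_distrib_left)
  finally show ?thesis
    by (simp add: has_field_derivative_def)
qed

text \<open>The integral of \<open>p x * W (norm x)\<close> over the ball does not change when \<open>x\<close> is rotated, so its
  derivative in the rotation angle vanishes. Dominated convergence moves the derivative under the
  integral: by the mean value theorem the difference quotients are values of the derivative along the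
  orbit, and these are bounded because the derivative is again homogeneous of degree \<open>Suc d\<close>.\<close>

lemma has_integral_rotation_derivative:
  assumes p: "hompoly (Suc d) p" and ij: "i \<noteq> j"
    and W: "continuous_on {0<..1} W" "\<And>r. 0 < r \<Longrightarrow> r \<le> 1 \<Longrightarrow> \<bar>r ^ Suc d * W r\<bar> \<le> M"
  shows "((\<lambda>x. (x $ i * partial_deriv j p x - x $ j * partial_deriv i p x) * W (norm x))
    has_integral 0) punctured_ball"
proof -
  define Dp where "Dp = (\<lambda>x. x $ i * partial_deriv j p x - x $ j * partial_deriv i p x)"
  let ?R = "plane_rotation i j"
  have R: "orthogonal_transformation (?R t)" for t
    by (rule orthogonal_transformation_plane_rotation[OF ij])
  define t where "t = (\<lambda>n. inverse (real (Suc n)))"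
  have t: "t n > 0" for n by (simp add: t_def)
  define F where "F = (\<lambda>n x. (p (?R (t n) x) - p x) / t n * W (norm x))"
  define g where "g = (\<lambda>x. p x * W (norm x))"
  have "hompoly (Suc d) (\<lambda>x. x $ i * partial_deriv j p x + - 1 * (x $ j * partial_deriv i p x))"
    using hompoly_partial_deriv[OF p] by (intro hompoly.add hompoly_scale hompoly.coord) simp_all
  then have "hompoly (Suc d) Dp"
    by (simp add: Dp_def)
  then obtain C where C: "C \<ge> 0" "\<And>x. \<bar>Dp x\<bar> \<le> C * norm x ^ Suc d"
    using hompoly_bound by blast
  have DERIV: "((\<lambda>t. p (?R t x)) has_field_derivative Dp (?R t x)) (at t)" for t x
    unfolding Dp_def by (rule hompoly_rotation_derivative[OF p ij])
  have g: "g absolutely_integrable_on punctured_ball"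
    unfolding g_def using p W by (rule absolutely_integrable_hompoly_radial)
  note gR = integral_orthogonal_image_real[OF R orthogonal_transformation_punctured_ball[OF R] g]
  have F_eq: "F n = (\<lambda>x. (g (?R (t n) x) - g x) / t n)" for n
    by (simp add: F_def g_def fun_eq_iff diff_divide_distrib left_diff_distrib
        orthogonal_transformation_norm[OF R])
  have integrable: "g integrable_on punctured_ball" "(\<lambda>x. g (?R t x)) integrable_on punctured_ball" for t
    using g gR(1) by (auto dest: set_lebesgue_integral_eq_integral(1))
  have F: "F n integrable_on punctured_ball" "integral punctured_ball (F n) = 0" for n
    unfolding F_eq using integrable gR(2)
    by (auto simp: integral_diff intro!: integrable_on_divide integrable_diff)
  have bound: "norm (F n x) \<le> C * M" if x: "x \<in> punctured_ball" for n x
  proof -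
    obtain z where z: "p (?R (t n) x) - p (?R 0 x) = (t n - 0) * Dp (?R z x)"
      using MVT2[OF t DERIV] by blast
    have "norm (F n x) = \<bar>Dp (?R z x)\<bar> * \<bar>W (norm x)\<bar>"
      using z t[of n] by (simp add: F_def plane_rotation_0 abs_mult)
    also have "\<dots> \<le> C * norm x ^ Suc d * \<bar>W (norm x)\<bar>"
      using C(2)[of "?R z x"] by (intro mult_right_mono) (simp_all add: orthogonal_transformation_norm[OF R])
    also have "\<dots> = C * \<bar>norm x ^ Suc d * W (norm x)\<bar>"
      by (simp add: abs_mult)
    also have "\<dots> \<le> C * M"
      using x C(1) W(2)[of "norm x"] by (intro mult_left_mono) (auto simp: punctured_ball_def)
    finally show ?thesis .
  qed
  have "filterlim t (at 0) sequentially"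
    using t LIMSEQ_inverse_real_of_nat unfolding t_def by (intro filterlim_atI) auto
  then have conv: "(\<lambda>n. F n x) \<longlonglongrightarrow> Dp x * W (norm x)" for x
    unfolding F_def
    using filterlim_compose[OF DERIV[of x 0, unfolded DERIV_def]]
    by (intro tendsto_mult tendsto_const) (auto simp: plane_rotation_0)
  have const: "(\<lambda>x::real^3. C * M) integrable_on punctured_ball"
    using punctured_ball_measurable by (rule integrable_on_const)
  note lim = dominated_convergence[OF F(1) const bound conv]
  have "integral punctured_ball (\<lambda>x. Dp x * W (norm x)) = 0"
    using lim(2) unfolding F(2) by (simp add: LIMSEQ_const_iff)
  with lim(1) show ?thesis
    by (simp add: has_integral_iff Dp_def)
qed

section \<open>Harmonic polynomials are orthogonal to the coordinates\<close>

lemma norm_power2_sum: "(\<Sum>i\<in>UNIV. x $ i * x $ i) = norm x ^ 2" for x :: "real ^ 3"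
  by (simp add: power2_norm_eq_inner inner_vec_def)

text \<open>The orthogonality of spherical harmonics of degree \<open>l \<ge> 2\<close> and degree 1. Write \<open>\<langle>f\<rangle>\<close> for the
  integral of \<open>f / norm x ^ l\<close> over the ball and \<open>p\<^sub>j\<close> for the partial derivatives of \<open>p\<close>. Rotation
  invariance gives \<open>\<langle>(x\<^sub>j \<partial>\<^sub>k - x\<^sub>k \<partial>\<^sub>j) f\<rangle> = 0\<close>, also with an additional factor \<open>(norm x)\<^sup>2\<close>. For
  \<open>f = p\<^sub>j\<close> with that factor, summed over \<open>j\<close>, harmonicity removes the second part and Euler's
  identity turns the first one into \<open>(l - 1) \<langle>(norm x)\<^sup>2 p\<^sub>k\<rangle> = 0\<close>; here \<open>l \<noteq> 1\<close> is essential. For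
  \<open>f = x\<^sub>j p\<close>, summed over \<open>j\<close>, Euler's identity gives
  \<open>\<langle>(norm x)\<^sup>2 p\<^sub>k\<rangle> = (l + 2) \<langle>x\<^sub>k p\<rangle>\<close>.\<close>

lemma has_integral_harmonic_coord:
  assumes p: "hompoly l p" and l: "l \<ge> 2" and harmonic: "\<And>x. laplacian p x = 0"
  shows "((\<lambda>x. x $ k * p x / norm x ^ l) has_integral 0) punctured_ball"
proof -
  let ?p = "\<lambda>i. partial_deriv i p"
  have euler: "(\<Sum>j\<in>UNIV. x $ j * ?p j x) = l * p x" for x
    by (rule hompoly_euler[OF p])
  have lap: "(\<Sum>j\<in>UNIV. partial_deriv j (?p j) x) = 0" for x
    using harmonic[of x] by (simp add: laplacian_def)
  have euler': "(\<Sum>j\<in>UNIV. x $ j * partial_deriv k (?p j) x) = (real l - 1) * ?p k x" for x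
    by (rule hompoly_euler_partial_deriv[OF p])

  (* First family: the functions \<open>p\<^sub>j\<close>, with weight \<open>(norm x)\<^sup>2 / norm x ^ l\<close>. *)
  have pj: "hompoly (Suc (l - 2)) (?p j)" for j
  proof -
    have "l - 1 = Suc (l - 2)" using l by simp
    then show ?thesis using hompoly_partial_deriv[OF p, of j] by simp
  qed
  have "((\<lambda>x. (x $ j * partial_deriv k (?p j) x - x $ k * partial_deriv j (?p j) x) *
      ((norm x)\<^sup>2 / norm x ^ l)) has_integral 0) punctured_ball" for j
  proof (cases "j = k")
    case False
    have "\<bar>r ^ Suc (l - 2) * (r\<^sup>2 / r ^ l)\<bar> \<le> 1" if "0 < r" "r \<le> 1" for r :: real
    proof -
      have "r ^ Suc (l - 2) * r\<^sup>2 = r * r ^ l"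
        using le_Suc_ex[OF l] by (auto simp: power2_eq_square)
      then have "r ^ Suc (l - 2) * (r\<^sup>2 / r ^ l) = r"
        using that by (simp del: power_Suc)
      then show ?thesis using that by simp
    qed
    then show ?thesis
      by (rule has_integral_rotation_derivative[OF pj False, rotated]) (auto intro!: continuous_intros)
  qed simp
  then have "((\<lambda>x. \<Sum>j\<in>UNIV. (x $ j * partial_deriv k (?p j) x - x $ k * partial_deriv j (?p j) x) *
      ((norm x)\<^sup>2 / norm x ^ l)) has_integral (\<Sum>j\<in>(UNIV::3 set). 0)) punctured_ball"
    by (intro has_integral_sum) auto
  moreover have "(\<Sum>j\<in>UNIV. (x $ j * partial_deriv k (?p j) x - x $ k * partial_deriv j (?p j) x) *
      ((norm x)\<^sup>2 / norm x ^ l)) = (real l - 1) * (?p k x * (norm x)\<^sup>2 / norm x ^ l)" for x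
  proof -
    have "(\<Sum>j\<in>UNIV. x $ j * partial_deriv k (?p j) x - x $ k * partial_deriv j (?p j) x) = (real l - 1) * ?p k x"
      by (simp add: sum_subtractf euler' lap flip: sum_distrib_left)
    then show ?thesis
      unfolding sum_distrib_right[symmetric] by simp
  qed
  ultimately have "((\<lambda>x. (real l - 1) * (?p k x * (norm x)\<^sup>2 / norm x ^ l)) has_integral 0) punctured_ball"
    by simp
  from has_integral_mult_right[OF this, of "1 / (real l - 1)"] l
  have A: "((\<lambda>x. ?p k x * (norm x)\<^sup>2 / norm x ^ l) has_integral 0) punctured_ball"
    by simp

  (* Second family: the functions \<open>x\<^sub>j p\<close>, with weight \<open>1 / norm x ^ l\<close>. *)
  let ?q = "\<lambda>j x. x $ j * p x"
  have "((\<lambda>x. (x $ j * partial_deriv k (?q j) x - x $ k * partial_deriv j (?q j) x) *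
      (1 / norm x ^ l)) has_integral 0) punctured_ball" for j
  proof (cases "j = k")
    case False
    then show ?thesis
      by (intro has_integral_rotation_derivative[OF hompoly.coord[OF p] False, where M = 1])
        (auto intro!: continuous_intros)
  qed simp
  then have "((\<lambda>x. \<Sum>j\<in>UNIV. (x $ j * partial_deriv k (?q j) x - x $ k * partial_deriv j (?q j) x) *
      (1 / norm x ^ l)) has_integral (\<Sum>j\<in>(UNIV::3 set). 0)) punctured_ball"
    by (intro has_integral_sum) auto
  moreover have "(\<Sum>j\<in>UNIV. (x $ j * partial_deriv k (?q j) x - x $ k * partial_deriv j (?q j) x) *
      (1 / norm x ^ l)) = ?p k x * (norm x)\<^sup>2 / norm x ^ l - (l + 2) * (x $ k * p x / norm x ^ l)" for x
  proof -
    have "(\<Sum>j\<in>UNIV. x $ j * partial_deriv k (?q j) x - x $ k * partial_deriv j (?q j) x) =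
        (\<Sum>j\<in>UNIV. (if k = j then x $ j * p x else 0) + (x $ j * x $ j) * ?p k x
           - x $ k * p x - x $ k * (x $ j * ?p j x))"
      unfolding partial_deriv_coord_mult[OF p] by (intro sum.cong) (auto simp: algebra_simps)
    also have "\<dots> = x $ k * p x + (norm x)\<^sup>2 * ?p k x - 3 * (x $ k * p x) - x $ k * (l * p x)"
      by (simp add: sum_subtractf sum.distrib norm_power2_sum euler
          flip: sum_distrib_left sum_distrib_right)
    also have "\<dots> = ?p k x * (norm x)\<^sup>2 - (l + 2) * (x $ k * p x)"
      by (simp add: algebra_simps)
    finally show ?thesis
      unfolding sum_distrib_right[symmetric] by (simp add: diff_divide_distrib)
  qed
  ultimately have "((\<lambda>x. ?p k x * (norm x)\<^sup>2 / norm x ^ l - (l + 2) * (x $ k * p x / norm x ^ l))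
      has_integral 0) punctured_ball"
    by simp
  from has_integral_diff[OF A this]
  have "((\<lambda>x. (l + 2) * (x $ k * p x / norm x ^ l)) has_integral 0) punctured_ball"
    by simp
  from has_integral_mult_right[OF this, of "1 / (l + 2)"] show ?thesis
    by simp
qed

section \<open>The body as a radial rescaling of the ball\<close>

text \<open>The matrix is \<open>a\<close> times the identity plus the rank-one matrix with column \<open>y\<close> and row
  \<open>\<phi>\<close>; its determinant is \<open>a\<^sup>3 + a\<^sup>2 \<phi> y\<close>.\<close>

lemma det_scale_plus_rank_one:
  fixes \<phi> :: "real ^ 3 \<Rightarrow> real"
  assumes "linear \<phi>" "\<phi> y = 0"
  shows "det (matrix (\<lambda>v. a *\<^sub>R v + \<phi> v *\<^sub>R y)) = a ^ 3"
proof -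
  let ?w = "\<lambda>i. \<phi> (axis i 1)"
  have "y = (\<Sum>i\<in>UNIV. y $ i *\<^sub>R axis i 1)"
    using basis_expansion[of y] by (simp add: scalar_mult_eq_scaleR)
  then have "\<phi> y = \<phi> (\<Sum>i\<in>UNIV. y $ i *\<^sub>R axis i 1)"
    by (rule arg_cong)
  also have "\<dots> = (\<Sum>i\<in>UNIV. y $ i * ?w i)"
    by (simp add: linear_sum[OF assms(1)] linear_cmul[OF assms(1)])
  finally have orth: "y $ 1 * ?w 1 + y $ 2 * ?w 2 + y $ 3 * ?w 3 = 0"
    using assms(2) by (simp add: sum_3)
  have "matrix (\<lambda>v. a *\<^sub>R v + \<phi> v *\<^sub>R y) $ i $ j = (if i = j then a else 0) + ?w j * y $ i" for i j
    by (auto simp: matrix_def axis_def)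
  then have "det (matrix (\<lambda>v. a *\<^sub>R v + \<phi> v *\<^sub>R y)) =
      a ^ 3 + a ^ 2 * (y $ 1 * ?w 1 + y $ 2 * ?w 2 + y $ 3 * ?w 3)"
    by (simp add: det_3 algebra_simps power2_eq_square power3_eq_cube)
  then show ?thesis
    using orth by simp
qed

lemma derivative_radial_eq_0:
  fixes G :: "'a::real_normed_vector \<Rightarrow> 'b::real_normed_vector"
  assumes G: "(G has_derivative G') (at x)" and homog: "\<And>c. c > 0 \<Longrightarrow> G (c *\<^sub>R x) = G x"
  shows "G' x = 0"
proof -
  have "((\<lambda>t. t *\<^sub>R x) has_derivative (\<lambda>t. t *\<^sub>R x)) (at 1)"
    by (auto intro!: derivative_eq_intros)
  then have "((\<lambda>t. G (t *\<^sub>R x)) has_derivative (\<lambda>t. G' (t *\<^sub>R x))) (at 1)"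
    by (rule has_derivative_compose) (simp add: G)
  moreover have "((\<lambda>t::real. G (t *\<^sub>R x)) has_derivative (\<lambda>t. 0)) (at 1)"
    by (rule has_derivative_transform_within_open[of "\<lambda>t. G x" _ _ _ "{0<..}"]) (auto simp: homog)
  ultimately have "(\<lambda>t. G' (t *\<^sub>R x)) = (\<lambda>t. 0)"
    by (rule has_derivative_unique)
  from fun_cong[OF this, of 1] show ?thesis by simp
qed

lemma body_eq_insert_image:
  assumes homog: "\<And>c x. c > 0 \<Longrightarrow> G (c *\<^sub>R x) = G x"
    and pos: "\<And>x. x \<noteq> 0 \<Longrightarrow> 1 + \<epsilon> * G x > 0"
  shows "body G \<epsilon> = insert 0 ((\<lambda>x. (1 + \<epsilon> * G x) *\<^sub>R x) ` punctured_ball)"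
proof (intro equalityI subsetI)
  fix y assume "y \<in> body G \<epsilon>"
  then obtain t u where y: "y = t *\<^sub>R u" and u: "norm u = 1" and t: "0 \<le> t" "t \<le> 1 + \<epsilon> * G u"
    by (auto simp: body_def)
  show "y \<in> insert 0 ((\<lambda>x. (1 + \<epsilon> * G x) *\<^sub>R x) ` punctured_ball)"
  proof (cases "t = 0")
    case False
    let ?r = "1 + \<epsilon> * G u"
    let ?x = "(t / ?r) *\<^sub>R u"
    have "u \<noteq> 0" using u by auto
    then have r: "?r > 0" by (rule pos)
    then have "G ?x = G u" using False t(1) by (intro homog) auto
    then have "y = (1 + \<epsilon> * G ?x) *\<^sub>R ?x" using y r by simp
    moreover have "?x \<in> punctured_ball"
      using u t False r by (auto simp: punctured_ball_def)
    ultimately show ?thesis by blast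
  qed (use y in simp)
next
  fix y assume "y \<in> insert 0 ((\<lambda>x. (1 + \<epsilon> * G x) *\<^sub>R x) ` punctured_ball)"
  then show "y \<in> body G \<epsilon>"
  proof
    assume "y = 0"
    moreover have "axis 1 1 \<in> sphere (0 :: real ^ 3) 1" by simp
    moreover have "1 + \<epsilon> * G (axis 1 1) > 0" by (rule pos) simp
    ultimately show ?thesis
      unfolding body_def by (intro CollectI exI[of _ 0] exI[of _ "axis 1 1"]) auto
  next
    assume "y \<in> (\<lambda>x. (1 + \<epsilon> * G x) *\<^sub>R x) ` punctured_ball"
    then obtain x where "x \<in> punctured_ball" and y: "y = (1 + \<epsilon> * G x) *\<^sub>R x"
      by blast
    then have x: "x \<noteq> 0" "norm x \<le> 1"
      by (simp_all add: punctured_ball_def)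
    let ?u = "(1 / norm x) *\<^sub>R x"
    have "G ?u = G x" using x(1) by (intro homog) simp
    then have "(1 + \<epsilon> * G x) * norm x \<le> 1 + \<epsilon> * G ?u"
      using x pos[of x] by (simp add: mult_left_le)
    then show ?thesis
      unfolding body_def using x y pos[of x]
      by (intro CollectI exI[of _ "(1 + \<epsilon> * G x) * norm x"] exI[of _ ?u]) auto
  qed
qed

lemma inj_on_radial_rescaling:
  assumes homog: "\<And>c x. c > 0 \<Longrightarrow> G (c *\<^sub>R x) = G x"
    and pos: "\<And>x :: real ^ 3. x \<noteq> 0 \<Longrightarrow> 1 + \<epsilon> * G x > 0"
  shows "inj_on (\<lambda>x. (1 + \<epsilon> * G x) *\<^sub>R x) (- {0})"
proof (rule inj_onI)
  fix x y :: "real ^ 3"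
  assume "x \<in> - {0}" "y \<in> - {0}" and eq: "(1 + \<epsilon> * G x) *\<^sub>R x = (1 + \<epsilon> * G y) *\<^sub>R y"
  then have rx: "1 + \<epsilon> * G x > 0" and ry: "1 + \<epsilon> * G y > 0" using pos by auto
  have "G x = G ((1 + \<epsilon> * G x) *\<^sub>R x)" using homog[OF rx] by simp
  also have "\<dots> = G y" unfolding eq using homog[OF ry] by simp
  finally show "x = y" using eq ry by simp
qed

text \<open>The map \<open>x \<mapsto> r x\<close> with \<open>r = 1 + \<epsilon> * G x\<close> carries the punctured ball to the body without the
  origin. Its derivative is \<open>r\<close> times the identity plus a rank-one map that sends \<open>x\<close> itself to
  \<open>0\<close>, because \<open>G\<close> is constant along rays. Hence the Jacobian determinant is \<open>r\<^sup>3\<close>, and the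
  integrand \<open>r x\<close> contributes the fourth factor.\<close>

lemma integral_body:
  assumes homog: "\<And>c x. c > 0 \<Longrightarrow> G (c *\<^sub>R x) = G x"
    and der: "\<And>x. x \<noteq> 0 \<Longrightarrow> (G has_derivative G' x) (at x)"
    and bound: "\<And>x. x \<noteq> 0 \<Longrightarrow> \<bar>G x\<bar> \<le> C"
    and pos: "\<And>x. x \<noteq> 0 \<Longrightarrow> 1 + \<epsilon> * G x > 0"
  shows "(\<lambda>x. x) absolutely_integrable_on body G \<epsilon>"
    and "integral (body G \<epsilon>) (\<lambda>x. x) = integral punctured_ball (\<lambda>x. (1 + \<epsilon> * G x) ^ 4 *\<^sub>R x)"
proof -
  let ?r = "\<lambda>x. 1 + \<epsilon> * G x"
  let ?h = "\<lambda>x. ?r x *\<^sub>R x"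
  let ?h' = "\<lambda>x v. ?r x *\<^sub>R v + (\<epsilon> * G' x v) *\<^sub>R x"
  have h: "(?h has_derivative ?h' x) (at x within punctured_ball)" if "x \<in> punctured_ball" for x
  proof -
    have "x \<noteq> 0" using that by (simp add: punctured_ball_def)
    note has_derivative_at_withinI[OF der[OF this], of punctured_ball, derivative_intros]
    show ?thesis by (auto intro!: derivative_eq_intros)
  qed
  have det: "\<bar>det (matrix (?h' x))\<bar> = ?r x ^ 3" if "x \<in> punctured_ball" for x
  proof -
    have x: "x \<noteq> 0" using that by (simp add: punctured_ball_def)
    have "linear (\<lambda>v. \<epsilon> * G' x v)"
      using linear_compose_scale_right[OF has_derivative_linear[OF der[OF x]], of \<epsilon>] by simp
    moreover have "G' x x = 0"
      using der[OF x] homog by (rule derivative_radial_eq_0)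
    ultimately have "det (matrix (?h' x)) = ?r x ^ 3"
      by (intro det_scale_plus_rank_one) simp_all
    then show ?thesis using pos[OF x] by simp
  qed
  have integrand: "\<bar>det (matrix (?h' x))\<bar> *\<^sub>R ?h x = ?r x ^ 4 *\<^sub>R x" if "x \<in> punctured_ball" for x
    using det[OF that] by (simp add: power_Suc2 numeral_eq_Suc del: power_Suc)
  have "continuous_on punctured_ball G"
    using der by (intro continuous_at_imp_continuous_on)
      (auto simp: punctured_ball_def intro: has_derivative_continuous)
  moreover have "norm (?r x ^ 4 *\<^sub>R x) \<le> (1 + \<bar>\<epsilon>\<bar> * C) ^ 4" if x: "x \<in> punctured_ball" for x
  proof -
    have "\<bar>\<epsilon> * G x\<bar> \<le> \<bar>\<epsilon>\<bar> * C"
      using x bound[of x] by (auto simp: punctured_ball_def abs_mult mult_left_mono)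
    then have "?r x ^ 4 \<le> (1 + \<bar>\<epsilon>\<bar> * C) ^ 4"
      using x pos[of x] by (intro power_mono) (auto simp: punctured_ball_def)
    moreover have "norm x \<le> 1" using x by (simp add: punctured_ball_def)
    ultimately show ?thesis
      using mult_mono[of "?r x ^ 4" "(1 + \<bar>\<epsilon>\<bar> * C) ^ 4" "norm x" 1] by simp
  qed
  ultimately have "(\<lambda>x. ?r x ^ 4 *\<^sub>R x) absolutely_integrable_on punctured_ball"
    by (intro absolutely_integrable_punctured_ball continuous_intros)
  moreover have "(\<lambda>x. \<bar>det (matrix (?h' x))\<bar> *\<^sub>R ?h x) absolutely_integrable_on punctured_ball \<longleftrightarrow>
     (\<lambda>x. ?r x ^ 4 *\<^sub>R x) absolutely_integrable_on punctured_ball"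
    using integrand by (intro set_integrable_cong) auto
  moreover have "integral punctured_ball (\<lambda>x. \<bar>det (matrix (?h' x))\<bar> *\<^sub>R ?h x) =
     integral punctured_ball (\<lambda>x. ?r x ^ 4 *\<^sub>R x)"
    using integrand by (intro integral_cong) auto
  moreover have "inj_on ?h punctured_ball"
    using inj_on_radial_rescaling[of G \<epsilon>, OF homog pos]
    by (rule inj_on_subset) (auto simp: punctured_ball_def)
  ultimately have image: "(\<lambda>x. x) absolutely_integrable_on ?h ` punctured_ball"
      "integral (?h ` punctured_ball) (\<lambda>x. x) = integral punctured_ball (\<lambda>x. ?r x ^ 4 *\<^sub>R x)"
    using has_absolute_integral_change_of_variables[OF fmeasurableD[OF punctured_ball_measurable] h,
      of "\<lambda>x. x" "integral punctured_ball (\<lambda>x. ?r x ^ 4 *\<^sub>R x)"] by blast+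
  have body: "body G \<epsilon> = insert 0 (?h ` punctured_ball)"
    by (rule body_eq_insert_image[OF homog pos])
  (* The identity vanishes at the origin, so adding that point changes no integral. *)
  have spike: "negligible {x \<in> insert 0 S - S. x \<noteq> 0}" "negligible {x \<in> S - insert 0 S. x \<noteq> 0}"
    for S :: "(real ^ 3) set"
    by (auto intro: negligible_subset[of "{}"])
  show "(\<lambda>x. x) absolutely_integrable_on body G \<epsilon>"
    unfolding body using absolutely_integrable_spike_set_eq[OF spike] image(1) by blast
  show "integral (body G \<epsilon>) (\<lambda>x. x) = integral punctured_ball (\<lambda>x. (1 + \<epsilon> * G x) ^ 4 *\<^sub>R x)"
    unfolding body using integral_spike_set[OF spike] image(2) by simp
qed

lemma compact_body:
  assumes cont: "continuous_on (sphere 0 1) G" and pos: "\<And>u. norm u = 1 \<Longrightarrow> 1 + \<epsilon> * G u \<ge> 0"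
  shows "compact (body G \<epsilon>)"
proof -
  let ?f = "\<lambda>(s, u). (s * (1 + \<epsilon> * G u)) *\<^sub>R u"
  have "body G \<epsilon> = ?f ` ({0..1} \<times> sphere 0 1)"
  proof (intro equalityI subsetI)
    fix y assume "y \<in> body G \<epsilon>"
    then obtain t u where y: "y = t *\<^sub>R u" "norm u = 1" "0 \<le> t" "t \<le> 1 + \<epsilon> * G u"
      by (auto simp: body_def)
    let ?s = "t / (1 + \<epsilon> * G u)"
    have "y = ?f (?s, u)" "?s \<in> {0..1}"
      using y by (auto simp: divide_simps)
    then show "y \<in> ?f ` ({0..1} \<times> sphere 0 1)" using y(2) by (intro image_eqI[of _ _ "(?s, u)"]) auto
  next
    fix y assume "y \<in> ?f ` ({0..1} \<times> sphere 0 1)"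
    then obtain s u where y: "y = (s * (1 + \<epsilon> * G u)) *\<^sub>R u" "norm u = 1" "0 \<le> s" "s \<le> 1"
      by auto
    then show "y \<in> body G \<epsilon>"
      unfolding body_def using pos[of u]
      by (intro CollectI exI[of _ "s * (1 + \<epsilon> * G u)"] exI[of _ u])
        (auto simp: mult_left_le_one_le)
  qed
  moreover have "compact (?f ` ({0..1} \<times> sphere 0 1))"
    unfolding split_beta
    by (intro compact_continuous_image continuous_intros continuous_on_compose2[OF cont] compact_Times) auto
  ultimately show ?thesis by simp
qed

lemma body_cong:
  assumes "\<And>u. norm u = 1 \<Longrightarrow> g u = h u"
  shows "body g \<epsilon> = body h \<epsilon>"
proof -
  have "u \<in> sphere 0 1 \<and> 0 \<le> t \<and> t \<le> 1 + \<epsilon> * g u \<longleftrightarrow>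
      u \<in> sphere 0 1 \<and> 0 \<le> t \<and> t \<le> 1 + \<epsilon> * h u" for t u
    using assms by auto
  then show ?thesis
    unfolding body_def by simp
qed

section \<open>The centroid is of second order in the perturbation\<close>

lemma has_integral_id_punctured_ball:
  "((\<lambda>x. x) has_integral (0 :: real ^ 3)) punctured_ball"
proof -
  have ai: "(\<lambda>x. x :: real ^ 3) absolutely_integrable_on punctured_ball"
    by (rule absolutely_integrable_punctured_ball[where M = 1]) (auto simp: punctured_ball_def)
  have T: "orthogonal_transformation (uminus :: real ^ 3 \<Rightarrow> _)"
    by (auto simp: orthogonal_transformation linear_uminus intro: linearI)
  have "integral punctured_ball (\<lambda>x. - x) = integral punctured_ball (\<lambda>x. x)"
    using integral_orthogonal_image(2)[OF T orthogonal_transformation_punctured_ball[OF T] ai] .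
  then have "integral punctured_ball (\<lambda>x. x) = 0"
    by (simp add: vec_eq_iff)
  then show ?thesis
    using ai by (simp add: has_integral_iff set_lebesgue_integral_eq_integral(1))
qed

text \<open>In the expansion of \<open>(1 + \<epsilon> * G x) ^ 4\<close> the constant term integrates to \<open>0\<close> against \<open>x\<close> by
  symmetry and the term linear in \<open>\<epsilon>\<close> does so by hypothesis; all other terms carry a factor
  \<open>\<epsilon>\<^sup>2\<close>. The volume in the denominator of the centroid is at least that of the ball of radius
  \<open>1 / 2\<close>, since \<open>1 + \<epsilon> * G x \<ge> 1 / 2\<close>.\<close>

lemma norm_centroid_body_le:
  assumes homog: "\<And>c x. c > 0 \<Longrightarrow> G (c *\<^sub>R x) = G x"
    and der: "\<And>x. x \<noteq> 0 \<Longrightarrow> (G has_derivative G' x) (at x)"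
    and bound: "\<And>x. x \<noteq> 0 \<Longrightarrow> \<bar>G x\<bar> \<le> C"
    and orth: "((\<lambda>x. G x *\<^sub>R x) has_integral 0) punctured_ball"
    and \<epsilon>: "\<bar>\<epsilon>\<bar> \<le> 1" "\<bar>\<epsilon>\<bar> * C \<le> 1 / 2"
  shows "norm (centroid (body G \<epsilon>)) \<le>
    (6 * C ^ 2 + 4 * C ^ 3 + C ^ 4) * measure lebesgue punctured_ball
      / measure lebesgue (cball (0 :: real ^ 3) (1 / 2)) * \<epsilon>\<^sup>2"
proof -
  let ?B = "body G \<epsilon>" and ?K = "6 * C ^ 2 + 4 * C ^ 3 + C ^ 4"
  have small: "\<bar>\<epsilon> * G x\<bar> \<le> 1 / 2" if "x \<noteq> 0" for x
  proof -
    have "\<bar>\<epsilon> * G x\<bar> \<le> \<bar>\<epsilon>\<bar> * C"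
      using bound[OF that] by (simp add: abs_mult mult_left_mono)
    then show ?thesis using \<epsilon>(2) by simp
  qed
  have lower: "1 + \<epsilon> * G x \<ge> 1 / 2" if "x \<noteq> 0" for x
    using small[OF that] by linarith
  then have pos: "1 + \<epsilon> * G x > 0" if "x \<noteq> 0" for x
    using that by fastforce
  have B: "(\<lambda>x. x) absolutely_integrable_on ?B"
    "integral ?B (\<lambda>x. x) = integral punctured_ball (\<lambda>x. (1 + \<epsilon> * G x) ^ 4 *\<^sub>R x)"
    using integral_body[of G G' C \<epsilon>] homog der bound pos by blast+
  have C: "C \<ge> 0"
    using bound[of "axis 1 1"] by simp

  have "(\<lambda>x. (1 + \<epsilon> * G x) ^ 4 *\<^sub>R x) integrable_on punctured_ball"
  proof (rule set_lebesgue_integral_eq_integral(1)[OF absolutely_integrable_punctured_ball])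
    have "continuous_on punctured_ball G"
      using der by (intro continuous_at_imp_continuous_on)
        (auto simp: punctured_ball_def intro: has_derivative_continuous)
    then show "continuous_on punctured_ball (\<lambda>x. (1 + \<epsilon> * G x) ^ 4 *\<^sub>R x)"
      by (intro continuous_intros)
    fix x assume x: "x \<in> punctured_ball"
    then have "\<bar>1 + \<epsilon> * G x\<bar> \<le> 2"
      using small[of x] by (auto simp: punctured_ball_def)
    then have "\<bar>1 + \<epsilon> * G x\<bar> ^ 4 \<le> 2 ^ 4"
      by (intro power_mono) auto
    then show "norm ((1 + \<epsilon> * G x) ^ 4 *\<^sub>R x) \<le> 2 ^ 4"
      using x mult_mono[of "\<bar>1 + \<epsilon> * G x\<bar> ^ 4" "2 ^ 4" "norm x" 1]
      by (simp add: punctured_ball_def power_abs)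
  qed
  then have N: "((\<lambda>x. (1 + \<epsilon> * G x) ^ 4 *\<^sub>R x) has_integral integral ?B (\<lambda>x. x)) punctured_ball"
    by (simp add: B(2) integrable_integral)
  have "((\<lambda>x. (1 + \<epsilon> * G x) ^ 4 *\<^sub>R x - (x + (4 * \<epsilon>) *\<^sub>R (G x *\<^sub>R x)))
      has_integral (integral ?B (\<lambda>x. x) - (0 + (4 * \<epsilon>) *\<^sub>R 0))) punctured_ball"
    by (intro has_integral_diff N has_integral_add has_integral_id_punctured_ball
        has_integral_cmul orth)
  moreover have "(1 + \<epsilon> * G x) ^ 4 *\<^sub>R x - (x + (4 * \<epsilon>) *\<^sub>R (G x *\<^sub>R x)) =
      (\<epsilon>\<^sup>2 * (6 * G x ^ 2 + 4 * \<epsilon> * G x ^ 3 + \<epsilon> ^ 2 * G x ^ 4)) *\<^sub>R x" for x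
  proof -
    have "(1 + \<epsilon> * G x) ^ 4 = 1 + 4 * \<epsilon> * G x + \<epsilon>\<^sup>2 * (6 * G x ^ 2 + 4 * \<epsilon> * G x ^ 3 + \<epsilon> ^ 2 * G x ^ 4)"
      by algebra
    then show ?thesis by (simp add: scaleR_left_distrib)
  qed
  ultimately have R: "((\<lambda>x. (\<epsilon>\<^sup>2 * (6 * G x ^ 2 + 4 * \<epsilon> * G x ^ 3 + \<epsilon> ^ 2 * G x ^ 4)) *\<^sub>R x)
      has_integral integral ?B (\<lambda>x. x)) punctured_ball"
    by simp
  have "norm ((\<epsilon>\<^sup>2 * (6 * G x ^ 2 + 4 * \<epsilon> * G x ^ 3 + \<epsilon> ^ 2 * G x ^ 4)) *\<^sub>R x) \<le> \<epsilon>\<^sup>2 * ?K"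
    if x: "x \<in> punctured_ball" for x
  proof -
    have g: "\<bar>G x\<bar> \<le> C" and n: "norm x \<le> 1"
      using x bound[of x] by (auto simp: punctured_ball_def)
    have gp: "\<bar>G x ^ n\<bar> \<le> C ^ n" for n
      using power_mono[OF g, of n] by (simp add: power_abs)
    have "\<bar>4 * \<epsilon> * G x ^ 3\<bar> \<le> 4 * C ^ 3"
      using mult_mono[OF \<epsilon>(1) gp[of 3]] by (simp add: abs_mult)
    moreover have "\<bar>\<epsilon> ^ 2 * G x ^ 4\<bar> \<le> C ^ 4"
      using mult_mono[OF power_mono[OF \<epsilon>(1), of 2] gp[of 4]] by (simp add: abs_mult)
    ultimately have "\<bar>6 * G x ^ 2 + 4 * \<epsilon> * G x ^ 3 + \<epsilon> ^ 2 * G x ^ 4\<bar> \<le> ?K"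
      using gp[of 2] by linarith
    then have "\<bar>6 * G x ^ 2 + 4 * \<epsilon> * G x ^ 3 + \<epsilon> ^ 2 * G x ^ 4\<bar> * norm x \<le> ?K * 1"
      using n by (intro mult_mono) auto
    then show ?thesis
      by (simp add: abs_mult mult.assoc mult_left_mono)
  qed
  then have "norm (integral ?B (\<lambda>x. x)) \<le> integral punctured_ball (\<lambda>x. \<epsilon>\<^sup>2 * ?K)"
    using integrable_on_const[OF punctured_ball_measurable]
      Henstock_Kurzweil_Integration.integral_norm_bound_integral[OF has_integral_integrable[OF R]]
    unfolding integral_unique[OF R] by blast
  also have "\<dots> = measure lebesgue punctured_ball * (\<epsilon>\<^sup>2 * ?K)"
    using lmeasure_integral[OF punctured_ball_measurable]
      integral_mult_left[of punctured_ball "\<lambda>x. 1" "\<epsilon>\<^sup>2 * ?K"] by simp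
  finally have num: "norm (integral ?B (\<lambda>x. x)) \<le> measure lebesgue punctured_ball * (\<epsilon>\<^sup>2 * ?K)" .

  have "compact ?B"
  proof (rule compact_body)
    have "isCont G u" if "norm u = 1" for u
    proof -
      have "u \<noteq> 0" using that by auto
      then show ?thesis by (rule has_derivative_continuous[OF der])
    qed
    then show "continuous_on (sphere 0 1) G"
      by (intro continuous_at_imp_continuous_on) auto
    show "1 + \<epsilon> * G u \<ge> 0" if "norm u = 1" for u
      using that by (intro less_imp_le pos) auto
  qed
  then have "?B \<in> lmeasurable"
    by (rule lmeasurable_compact)
  moreover have "cball 0 (1 / 2) \<subseteq> ?B"
  proof
    fix x :: "real ^ 3" assume x: "x \<in> cball 0 (1 / 2)"
    show "x \<in> ?B"
    proof (cases "x = 0")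
      case True
      then show ?thesis using body_eq_insert_image[of G \<epsilon>, OF homog pos] by blast
    next
      case False
      let ?u = "(1 / norm x) *\<^sub>R x"
      have "norm x \<le> 1 + \<epsilon> * G ?u"
        using lower[of ?u] x False by (simp)
      then show ?thesis
        unfolding body_def using False
        by (intro CollectI exI[of _ "norm x"] exI[of _ ?u]) auto
    qed
  qed
  ultimately have vol: "measure lebesgue (cball (0 :: real ^ 3) (1 / 2)) \<le> measure lebesgue ?B"
    by (intro measure_mono_fmeasurable) auto
  have vol0: "0 < measure lebesgue (cball (0 :: real ^ 3) (1 / 2))"
    using content_cball_pos[of "1/2" "0 :: real ^ 3"] by (simp add: measure_completion)

  have "norm (centroid ?B) = norm (integral ?B (\<lambda>x. x)) / measure lebesgue ?B"
    by (simp add: centroid_def set_lebesgue_integral_eq_integral(2)[OF B(1)])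
  also have "\<dots> \<le> measure lebesgue punctured_ball * (\<epsilon>\<^sup>2 * ?K) / measure lebesgue (cball (0 :: real ^ 3) (1 / 2))"
    by (rule frac_le[OF order_trans[OF norm_ge_zero num] num vol0 vol])
  finally show ?thesis
    by (simp add: mult_ac)
qed

lemma centroid_harmonic_body:
  assumes l: "l \<ge> 2" and g: "spherical_harmonic l g"
  shows "(\<lambda>\<epsilon>. norm (centroid (body g \<epsilon>))) \<in> O[at 0](\<lambda>\<epsilon>. \<epsilon>\<^sup>2)"
proof -
  obtain p where "homogeneous_polynomial l p" and harmonic: "\<And>x. laplacian p x = 0"
    and gp: "\<And>u. norm u = 1 \<Longrightarrow> g u = p u"
    using g unfolding spherical_harmonic_def by auto
  then have p: "hompoly l p"
    by (simp add: homogeneous_polynomial_imp_hompoly)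
  obtain C where C: "C \<ge> 0" "\<And>x. \<bar>p x\<bar> \<le> C * norm x ^ l"
    using hompoly_bound[OF p] by blast
  (* The extension of g from the sphere that is constant along rays. *)
  define G where "G = (\<lambda>x. p x / norm x ^ l)"
  have body: "body g \<epsilon> = body G \<epsilon>" for \<epsilon>
    by (rule body_cong) (simp add: G_def gp)
  have homog: "G (c *\<^sub>R x) = G x" if "c > 0" for c x
    using that by (simp add: G_def hompoly_scaleR[OF p] power_mult_distrib)
  have der: "(G has_derivative frechet_derivative G (at x)) (at x)" if "x \<noteq> 0" for x
  proof -
    have "p differentiable (at x)"
      using hompoly_has_derivative[OF p] by (auto simp: differentiable_def)
    then have "G differentiable (at x)"
      unfolding G_def using that
      by (intro differentiable_divide differentiable_power differentiable_norm_at) auto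
    then show ?thesis by (simp flip: frechet_derivative_works)
  qed
  have bound: "\<bar>G x\<bar> \<le> C" if "x \<noteq> 0" for x
    using that C(2)[of x] by (simp add: G_def divide_simps)
  have "((\<lambda>x. x $ k * p x / norm x ^ l) has_integral 0) punctured_ball" for k
    by (rule has_integral_harmonic_coord[OF p l harmonic])
  then have orth: "((\<lambda>x. G x *\<^sub>R x) has_integral 0) punctured_ball"
    by (subst has_integral_componentwise_iff) (auto simp: Basis_vec_def inner_axis G_def mult.commute)
  (* Dividing by "C + 1" makes both "\<epsilon>" and "\<epsilon> * C" small. *)
  have "\<forall>\<^sub>F \<epsilon> in at 0. \<bar>\<epsilon>\<bar> < (1 / 2) / (C + 1)"
    using C(1) by (intro order_tendstoD[OF tendsto_rabs_zero] tendsto_ident_at) simp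
  then have "\<forall>\<^sub>F \<epsilon> in at 0. norm (norm (centroid (body g \<epsilon>))) \<le>
      (6 * C ^ 2 + 4 * C ^ 3 + C ^ 4) * measure lebesgue punctured_ball
      / measure lebesgue (cball (0 :: real ^ 3) (1 / 2)) * norm (\<epsilon>\<^sup>2)"
  proof eventually_elim
    case (elim \<epsilon>)
    then have "\<bar>\<epsilon>\<bar> * (C + 1) \<le> 1 / 2"
      using C(1) less_imp_le[OF elim] by (subst (asm) pos_le_divide_eq) auto
    moreover have "\<bar>\<epsilon>\<bar> * (C + 1) = \<bar>\<epsilon>\<bar> * C + \<bar>\<epsilon>\<bar>" "\<bar>\<epsilon>\<bar> * C \<ge> 0"
      using C(1) by (simp_all add: distrib_left)
    ultimately have "\<bar>\<epsilon>\<bar> \<le> 1" "\<bar>\<epsilon>\<bar> * C \<le> 1 / 2"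
      by linarith+
    from norm_centroid_body_le[OF homog der bound orth this] show ?case
      by (simp add: body)
  qed
  then show ?thesis by (rule bigoI)
qed

section \<open>Exact vanishing by symmetry\<close>

text \<open>If the identity is not integrable on \<open>B\<close>, its Lebesgue integral is \<open>0\<close> by convention, which
  \<open>T\<close> fixes as well. Otherwise \<open>T\<close> commutes with the integral, and the substitution \<open>x \<mapsto> T x\<close>
  permutes \<open>B\<close>.\<close>

lemma orthogonal_transformation_centroid:
  assumes T: "orthogonal_transformation T" and B: "T ` B = B"
  shows "T (centroid B) = centroid B"
proof -
  have lin: "linear T" using T by (rule orthogonal_transformation_linear)
  have "T (LINT x:B|lebesgue. x) = (LINT x:B|lebesgue. x)"
  proof (cases "(\<lambda>x. x) absolutely_integrable_on B")
    case True
    then have "(\<lambda>x. x) integrable_on B"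
      by (rule set_lebesgue_integral_eq_integral(1))
    then have "T (integral B (\<lambda>x. x)) = integral B (\<lambda>x. T x)"
      using integral_linear[of "\<lambda>x. x" B T] lin by (simp add: linear_conv_bounded_linear o_def)
    also have "\<dots> = integral B (\<lambda>x. x)"
      by (rule integral_orthogonal_image(2)[OF T B True])
    finally show ?thesis
      by (simp add: set_lebesgue_integral_eq_integral(2)[OF True])
  next
    case False
    then have "(LINT x:B|lebesgue. x) = 0"
      by (simp add: set_integrable_def set_lebesgue_integral_def not_integrable_integral_eq)
    then show ?thesis using linear_0[OF lin] by simp
  qed
  then show ?thesis
    by (simp add: centroid_def linear_cmul[OF lin])
qed

lemma orthogonal_transformation_body:
  assumes T: "orthogonal_transformation T" and g: "\<And>u. norm u = 1 \<Longrightarrow> g (T u) = g u"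
  shows "T ` body g \<epsilon> = body g \<epsilon>"
proof
  note norm = orthogonal_transformation_norm[OF T]
  note scale = linear_cmul[OF orthogonal_transformation_linear[OF T]]
  show "T ` body g \<epsilon> \<subseteq> body g \<epsilon>"
  proof
    fix y assume "y \<in> T ` body g \<epsilon>"
    then obtain t u where "y = T (t *\<^sub>R u)" "norm u = 1" "0 \<le> t" "t \<le> 1 + \<epsilon> * g u"
      by (auto simp: body_def)
    then show "y \<in> body g \<epsilon>"
      unfolding body_def by (intro CollectI exI[of _ t] exI[of _ "T u"]) (auto simp: norm scale g)
  qed
  show "body g \<epsilon> \<subseteq> T ` body g \<epsilon>"
  proof
    fix y assume "y \<in> body g \<epsilon>"
    then obtain t u where y: "y = t *\<^sub>R u" "norm u = 1" "0 \<le> t" "t \<le> 1 + \<epsilon> * g u"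
      by (auto simp: body_def)
    obtain v where v: "u = T v"
      using orthogonal_transformation_surj[OF T] by (metis surjD)
    have "t *\<^sub>R v \<in> body g \<epsilon>"
      unfolding body_def using y v norm[of v] g[of v]
      by (intro CollectI exI[of _ t] exI[of _ v]) auto
    then show "y \<in> T ` body g \<epsilon>"
      unfolding y(1) v scale[symmetric] by (rule imageI)
  qed
qed

text \<open>Differentiation exchanges even (\<open>s = 1\<close>) and odd (\<open>s = -1\<close>) polynomials.\<close>

lemma poly_pderiv_reflect:
  fixes p :: "real poly"
  assumes "\<And>x. poly p (- x) = s * poly p x"
  shows "poly (pderiv p) (- x) = - s * poly (pderiv p) x"
proof -
  have "pcompose p [:0, -1:] = smult s p"
    unfolding poly_eq_poly_eq_iff[symmetric] using assms by (simp add: fun_eq_iff poly_pcompose)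
  then have "pderiv (pcompose p [:0, -1:]) = smult s (pderiv p)"
    by (simp add: pderiv_smult)
  then have "poly (pderiv (pcompose p [:0, -1:])) x = s * poly (pderiv p) x"
    by simp
  then show ?thesis
    by (simp add: pderiv_pcompose poly_pcompose pderiv_pCons)
qed

lemma poly_pderiv_funpow_reflect:
  fixes p :: "real poly"
  assumes "\<And>x. poly p (- x) = s * poly p x"
  shows "poly ((pderiv ^^ n) p) (- x) = (- 1) ^ n * s * poly ((pderiv ^^ n) p) x"
proof (induction n arbitrary: x)
  case (Suc n)
  from poly_pderiv_reflect[OF this] show ?case by simp
qed (simp add: assms)

lemma assoc_legendre_reflect: "assoc_legendre l m (- x) = (- 1) ^ (l + m) * assoc_legendre l m x"
proof -
  have "poly ([:-1, 0, 1:] ^ l) (- x) = 1 * poly ([:-1, 0, 1:] ^ l) x" for x :: real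
    by simp
  from poly_pderiv_funpow_reflect[OF this, of l]
  have "poly (legendre_poly l) (- x) = (- 1) ^ l * poly (legendre_poly l) x" for x
    by (simp add: legendre_poly_def)
  from poly_pderiv_funpow_reflect[OF this, of m] show ?thesis
    by (simp add: assoc_legendre_def power_add mult_ac)
qed

definition reflection3 :: "real ^ 3 \<Rightarrow> real ^ 3" where
  "reflection3 x = (\<chi> k. if k = 3 then - x $ 3 else x $ k)"

lemma orthogonal_transformation_reflection3: "orthogonal_transformation reflection3"
  unfolding orthogonal_transformation
proof (intro conjI allI)
  show "linear reflection3"
    by (rule linearI) (auto simp: reflection3_def vec_eq_iff)
  show "norm (reflection3 x) = norm x" for x
    by (simp add: norm_vec_def L2_set_def sum_3 reflection3_def)
qed

lemma plane_rotation_sphere_point: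
  "plane_rotation 1 2 \<alpha> (sphere_point \<theta> \<phi>) = sphere_point \<theta> (\<phi> + \<alpha>)"
  by (simp add: plane_rotation_def sphere_point_def vec_eq_iff forall_3 cos_add sin_add algebra_simps)

lemma reflection3_sphere_point: "reflection3 (sphere_point \<theta> \<phi>) = sphere_point (pi - \<theta>) \<phi>"
  by (simp add: reflection3_def sphere_point_def vec_eq_iff forall_3)

lemma sphere_point_cases:
  assumes "norm u = 1"
  obtains \<theta> \<phi> where "0 \<le> \<theta>" "\<theta> \<le> pi" "u = sphere_point \<theta> \<phi>"
proof
  have "\<bar>u $ 3\<bar> \<le> 1"
    using component_le_norm_cart[of u 3] assms by simp
  then show "0 \<le> colatitude u" "colatitude u \<le> pi"
    by (auto simp: colatitude_def intro: arccos_lbound arccos_ubound)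
  show "u = sphere_point (colatitude u) (longitude u)"
    by (rule sphere_point_angles[OF assms, symmetric])
qed

lemma Y_sphere_rotation:
  assumes "m \<ge> 1" "norm u = 1"
  shows "Y_sphere l m (plane_rotation 1 2 (2 * pi / m) u) = Y_sphere l m u"
proof -
  obtain \<theta> \<phi> where "0 \<le> \<theta>" "\<theta> \<le> pi" "u = sphere_point \<theta> \<phi>"
    using sphere_point_cases[OF assms(2)] .
  moreover have "m * (\<phi> + 2 * pi / m) = m * \<phi> + 2 * pi"
    using assms(1) by (simp add: field_simps)
  ultimately show ?thesis
    using assms(1) by (simp add: plane_rotation_sphere_point Y_sphere_point Y_angles_def)
qed

text \<open>The reflection \<open>\<theta> \<mapsto> pi - \<theta>\<close> multiplies the harmonic by \<open>(-1) ^ (l + m)\<close>. If that is \<open>-1\<close>, the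
  sign is undone by the rotation by \<open>pi / m\<close>, which reverses \<open>cos (m * \<phi>)\<close>.\<close>

lemma Y_sphere_rotary_reflection:
  fixes l m :: nat
  assumes "m \<ge> 1" "norm u = 1"
  defines "\<beta> \<equiv> if even (l + m) then 0 else pi / m"
  shows "Y_sphere l m (reflection3 (plane_rotation 1 2 \<beta> u)) = Y_sphere l m u"
proof -
  obtain \<theta> \<phi> where \<theta>: "0 \<le> \<theta>" "\<theta> \<le> pi" "u = sphere_point \<theta> \<phi>"
    using sphere_point_cases[OF assms(2)] .
  have "m * (\<phi> + \<beta>) = m * \<phi> + (if even (l + m) then 0 else pi)"
    using assms(1) by (simp add: \<beta>_def field_simps)
  then have "cos (m * (\<phi> + \<beta>)) = (- 1) ^ (l + m) * cos (m * \<phi>)"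
    by simp
  then show ?thesis
    using \<theta> assms(1)
    by (simp add: plane_rotation_sphere_point reflection3_sphere_point Y_sphere_point Y_angles_def
        assoc_legendre_reflect flip: power_mult_distrib)
qed

text \<open>In the \<open>(i, j)\<close> plane, only the origin is fixed by a rotation whose angle is not a multiple of
  \<open>2 * pi\<close>.\<close>

lemma plane_rotation_fixed_point:
  assumes "plane_rotation i j \<alpha> c = c" "i \<noteq> j" "cos \<alpha> \<noteq> 1"
  shows "c $ i = 0" "c $ j = 0"
proof -
  have i: "c $ i = cos \<alpha> * c $ i - sin \<alpha> * c $ j" and j: "c $ j = sin \<alpha> * c $ i + cos \<alpha> * c $ j"
    using arg_cong[OF assms(1), of "\<lambda>v. v $ i"] arg_cong[OF assms(1), of "\<lambda>v. v $ j"] assms(2)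
    by (simp_all add: plane_rotation_def)
  have "(1 - cos \<alpha>) * (c $ i * c $ i + c $ j * c $ j) = 0"
    using i j by algebra
  then show "c $ i = 0" "c $ j = 0"
    using assms(3) by simp_all
qed

text \<open>The body is invariant under the rotation by \<open>2 * pi / m\<close> about the third axis, and so is its
  centroid. That rotation is not the identity, since \<open>m \<ge> 2\<close>; hence the centroid lies on the
  axis. The rotary reflection is a symmetry too and reverses the axis.\<close>

lemma centroid_Y_sphere_body:
  assumes m: "m \<ge> 2" and g: "\<And>u. norm u = 1 \<Longrightarrow> g u = Y_sphere l m u"
  shows "centroid (body g \<epsilon>) = 0"
proof -
  define \<beta> where "\<beta> = (if even (l + m) then 0 else pi / m)"
  let ?c = "centroid (body g \<epsilon>)"
  let ?R = "plane_rotation 1 2 (2 * pi / m)"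
  let ?S = "reflection3 \<circ> plane_rotation 1 2 \<beta>"
  have rot: "orthogonal_transformation (plane_rotation 1 2 t)" for t
    by (rule orthogonal_transformation_plane_rotation) simp
  have S: "orthogonal_transformation ?S"
    by (intro orthogonal_transformation_compose orthogonal_transformation_reflection3 rot)
  have "g (?R u) = g u" "g (?S u) = g u" if "norm u = 1" for u
    using that m Y_sphere_rotation[of m u l] Y_sphere_rotary_reflection[of m u l]
      orthogonal_transformation_norm[OF rot] orthogonal_transformation_norm[OF S]
    by (simp_all add: g \<beta>_def)
  then have "?R ?c = ?c" "?S ?c = ?c"
    by (intro orthogonal_transformation_centroid orthogonal_transformation_body rot S; simp)+
  have "cos (2 * pi / m) < cos 0"
    using m by (intro cos_monotone_0_pi) (auto simp: field_simps)
  then have "?c $ 1 = 0" "?c $ 2 = 0"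
    using plane_rotation_fixed_point[OF \<open>?R ?c = ?c\<close>] by auto
  moreover have "?c $ 3 = 0"
    using arg_cong[OF \<open>?S ?c = ?c\<close>, of "\<lambda>v. v $ 3"] by (simp add: reflection3_def plane_rotation_def)
  ultimately show ?thesis
    by (simp add: vec_eq_iff forall_3)
qed

theorem lemma1:
  fixes l :: nat and g :: "real ^ 3 \<Rightarrow> real"
  assumes "l \<ge> 2"
  shows "(spherical_harmonic l g \<longrightarrow>
            (\<lambda>\<epsilon>. norm (centroid (body g \<epsilon>))) \<in> O[at 0](\<lambda>\<epsilon>. \<epsilon>\<^sup>2)) \<and>
         (\<forall>m. 2 \<le> m \<and> m \<le> l \<and> (\<forall>u\<in>sphere 0 1. g u = Y_sphere l m u) \<longrightarrow>
            (\<forall>\<epsilon>. (\<forall>u\<in>sphere 0 1. 1 + \<epsilon> * g u > 0) \<longrightarrow> centroid (body g \<epsilon>) = 0))"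
proof (intro conjI impI allI)
  show "(\<lambda>\<epsilon>. norm (centroid (body g \<epsilon>))) \<in> O[at 0](\<lambda>\<epsilon>. \<epsilon>\<^sup>2)" if "spherical_harmonic l g"
    by (rule centroid_harmonic_body[OF assms that])
  show "centroid (body g \<epsilon>) = 0" if "2 \<le> m \<and> m \<le> l \<and> (\<forall>u\<in>sphere 0 1. g u = Y_sphere l m u)" for m \<epsilon>
    using that by (intro centroid_Y_sphere_body[of m g l]) auto
qed

end
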